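(* Suppose $\varphi$ is a finitely valued, strictly increasing Orlicz function. Let $(E,\|\cdot\|_E)$ be a $p$-normed ideal space ($0<p\le 1$), complete and with the Fatou property, over a non-atomic measure space $(T,\Sigma,\mu)$, such that $E$ is uniformly monotone. Assume that neither $L_\infty\subset E$ nor $E\subset L_\infty$. If $(E_\varphi,\|\cdot\|_\varphi)$ is a quasi-normed space (that is, $\|\cdot\|_\varphi$ is a quasi-norm on $E_\varphi$), then $\alpha^a_\varphi>0$.
   Context: $(T,\Sigma,\mu)$ is a complete $\sigma$-finite measure space with $\mu(T)>0$; $L^0$ is the space of ($\mu$-a.e. classes of) real $\Sigma$-measurable functions on $T$, with the a.e. order; $L_\infty=L_\infty(T,\Sigma,\mu)$. A quasi-norm is a functional satisfying the axioms of a norm with the triangle inequality replaced by $\|x+y\|\le C(\|x\|+\|y\|)$ for some $C\ge1$. For $0<p\le1$, a $p$-norm is a functional with $\|x\|=0$ iff $x=0$, $\|ax\|=|a|\|x\|$, and $\|x+y\|^p\le\|x\|^p+\|y\|^p$. A $p$-normed ideal space is a linear subspace $E\subset L^0$ with a $p$-norm $\|\cdot\|_E$ such that (i) $x\in L^0$, $y\in E$, $|x|\le|y|$ a.e. imply $x\in E$, $\|x\|_E\le\|y\|_E$; (ii) some $x\in E$ is strictly positive on $T$. $E$ has the Fatou property if $0\le x_n\uparrow|x|$ a.e., $x_n\in E$, $x\in L^0$, $\sup_n\|x_n\|_E<\infty$ imply $x\in E$ and $\|x_n\|_E\to\|x\|_E$. $E_+=\{x\in E:x\ge0\}$. $E$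 is uniformly monotone if for each $\varepsilon>0$ there is $\delta=\delta(\varepsilon)>0$ such that for all $x,y\in E_+$ with $\|x\|_E=1$ and $\|y\|_E\ge\varepsilon$ we have $\|x+y\|_E\ge1+\delta$. An Orlicz function is a non-decreasing $\varphi:[0,\infty)\to[0,\infty]$ with $\varphi(0)=0$, right continuous at $0$, continuous on $(0,b_\varphi)$ and left continuous at $b_\varphi$, where $b_\varphi=\sup\{u\ge0:\varphi(u)<\infty\}$, and with $\lim_{u\to\infty}\varphi(u)=\infty$. $\rho^E_\varphi(x)=\|\varphi(|x|)\|_E$ if $\varphi(|x|)\in E$, and $=\infty$ otherwise ($x\in L^0$). Without any assumption on indices put $E_\varphi=\{x\in L^0:\lim_{\lambda\to0}\rho^E_\varphi(\lambda x)=0\}$ (a linear space) and $\|x\|_\varphi=\inf\{\lambda>0:\rho^E_\varphi(x/\lambda)\le1\}$ for $x\in E_\varphi$. $\alpha^a_\varphi=\sup\{q\in\mathbb R:\ \exists K\ge1\ \ \varphi(au)\le Ka^q\varphi(u)\ \text{for all }u\ge0,\ 0<a\le1\}$. *)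

theory Defs
  imports "HOL-Analysis.Analysis"
begin

text \<open>
  Elements of $L^0$ are represented by measurable functions rather than by their a.e. classes:
  equality, order and positivity of elements of $L^0$ are read almost everywhere. A subspace of
  $L^0$ is a set of representatives; for ideal spaces the ideal axiom \<open>ideal_norm\<close> makes both the
  set and the functional invariant under a.e. equality.
\<close>

abbreviation L0 :: "'a measure \<Rightarrow> ('a \<Rightarrow> real) set" where
  "L0 M \<equiv> borel_measurable M"

definition Linfty :: "'a measure \<Rightarrow> ('a \<Rightarrow> real) set" where
  "Linfty M = {x \<in> L0 M. \<exists>c. AE t in M. \<bar>x t\<bar> \<le> c}"

definition atom :: "'a measure \<Rightarrow> 'a set \<Rightarrow> bool" where
  "atom M A \<longleftrightarrow> A \<in> sets M \<and> emeasure M A > 0 \<and>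
     (\<forall>B \<in> sets M. B \<subseteq> A \<longrightarrow> emeasure M B = 0 \<or> emeasure M (A - B) = 0)"

definition non_atomic :: "'a measure \<Rightarrow> bool" where
  "non_atomic M \<longleftrightarrow> (\<forall>A. \<not> atom M A)"

definition linear_subspace :: "('a \<Rightarrow> real) set \<Rightarrow> bool" where
  "linear_subspace V \<longleftrightarrow> (\<lambda>t. 0) \<in> V \<and>
     (\<forall>x \<in> V. \<forall>y \<in> V. (\<lambda>t. x t + y t) \<in> V) \<and>
     (\<forall>c. \<forall>x \<in> V. (\<lambda>t. c * x t) \<in> V)"

definition quasi_norm_on :: "'a measure \<Rightarrow> ('a \<Rightarrow> real) set \<Rightarrow> (('a \<Rightarrow> real) \<Rightarrow> real) \<Rightarrow> bool" where
  "quasi_norm_on M V N \<longleftrightarrow>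
     (\<forall>x \<in> V. 0 \<le> N x) \<and>
     (\<forall>x \<in> V. N x = 0 \<longleftrightarrow> (AE t in M. x t = 0)) \<and>
     (\<forall>c. \<forall>x \<in> V. N (\<lambda>t. c * x t) = \<bar>c\<bar> * N x) \<and>
     (\<exists>C \<ge> 1. \<forall>x \<in> V. \<forall>y \<in> V. N (\<lambda>t. x t + y t) \<le> C * (N x + N y))"

definition p_norm_on ::
    "'a measure \<Rightarrow> real \<Rightarrow> ('a \<Rightarrow> real) set \<Rightarrow> (('a \<Rightarrow> real) \<Rightarrow> real) \<Rightarrow> bool" where
  "p_norm_on M p V N \<longleftrightarrow>
     (\<forall>x \<in> V. 0 \<le> N x) \<and>
     (\<forall>x \<in> V. N x = 0 \<longleftrightarrow> (AE t in M. x t = 0)) \<and>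
     (\<forall>c. \<forall>x \<in> V. N (\<lambda>t. c * x t) = \<bar>c\<bar> * N x) \<and>
     (\<forall>x \<in> V. \<forall>y \<in> V. N (\<lambda>t. x t + y t) powr p \<le> N x powr p + N y powr p)"

locale p_normed_ideal_space =
  fixes M :: "'a measure" and p :: real and E :: "('a \<Rightarrow> real) set" and N :: "('a \<Rightarrow> real) \<Rightarrow> real"
  assumes subset_L0: "E \<subseteq> L0 M"
    and subspace: "linear_subspace E"
    and p_norm: "p_norm_on M p E N"
    and ideal_norm: "\<And>x y. x \<in> L0 M \<Longrightarrow> y \<in> E \<Longrightarrow> (AE t in M. \<bar>x t\<bar> \<le> \<bar>y t\<bar>) \<Longrightarrow> x \<in> E \<and> N x \<le> N y"
    and strictly_positive: "\<exists>x \<in> E. AE t in M. 0 < x t"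

definition complete_space_on :: "('a \<Rightarrow> real) set \<Rightarrow> (('a \<Rightarrow> real) \<Rightarrow> real) \<Rightarrow> bool" where
  "complete_space_on E N \<longleftrightarrow>
     (\<forall>x :: nat \<Rightarrow> 'a \<Rightarrow> real.
        (\<forall>n. x n \<in> E) \<and>
        (\<forall>\<epsilon> > 0. \<exists>k. \<forall>m \<ge> k. \<forall>n \<ge> k. N (\<lambda>t. x m t - x n t) < \<epsilon>) \<longrightarrow>
        (\<exists>y \<in> E. (\<lambda>n. N (\<lambda>t. x n t - y t)) \<longlonglongrightarrow> 0))"

definition fatou_property :: "'a measure \<Rightarrow> ('a \<Rightarrow> real) set \<Rightarrow> (('a \<Rightarrow> real) \<Rightarrow> real) \<Rightarrow> bool" where
  "fatou_property M E N \<longleftrightarrow>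
     (\<forall>(x :: nat \<Rightarrow> 'a \<Rightarrow> real) y.
        (\<forall>n. x n \<in> E) \<and> y \<in> L0 M \<and>
        (AE t in M. (\<forall>n. 0 \<le> x n t) \<and> incseq (\<lambda>n. x n t) \<and> (\<lambda>n. x n t) \<longlonglongrightarrow> \<bar>y t\<bar>) \<and>
        bdd_above (range (\<lambda>n. N (x n))) \<longrightarrow>
        y \<in> E \<and> (\<lambda>n. N (x n)) \<longlonglongrightarrow> N y)"

definition positive_cone :: "'a measure \<Rightarrow> ('a \<Rightarrow> real) set \<Rightarrow> ('a \<Rightarrow> real) set" where
  "positive_cone M E = {x \<in> E. AE t in M. 0 \<le> x t}"

definition uniformly_monotone :: "'a measure \<Rightarrow> ('a \<Rightarrow> real) set \<Rightarrow> (('a \<Rightarrow> real) \<Rightarrow> real) \<Rightarrow> bool" where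
  "uniformly_monotone M E N \<longleftrightarrow>
     (\<forall>\<epsilon> > 0. \<exists>\<delta> > 0. \<forall>x \<in> positive_cone M E. \<forall>y \<in> positive_cone M E.
        N x = 1 \<and> N y \<ge> \<epsilon> \<longrightarrow> N (\<lambda>t. x t + y t) \<ge> 1 + \<delta>)"

text \<open>
  An Orlicz function maps $[0,\infty)$ to $[0,\infty]$; here it is a function on all reals whose values
  at negative arguments are irrelevant.
\<close>

definition orlicz_bound :: "(real \<Rightarrow> ennreal) \<Rightarrow> ereal" where
  "orlicz_bound \<phi> = Sup {ereal u | u. 0 \<le> u \<and> \<phi> u < \<infinity>}"

definition orlicz_function :: "(real \<Rightarrow> ennreal) \<Rightarrow> bool" where
  "orlicz_function \<phi> \<longleftrightarrow>
     mono_on {0..} \<phi> \<and> \<phi> 0 = 0 \<and>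
     continuous (at_right 0) \<phi> \<and>
     continuous_on {u. 0 < u \<and> ereal u < orlicz_bound \<phi>} \<phi> \<and>
     (\<forall>b > 0. ereal b = orlicz_bound \<phi> \<longrightarrow> continuous (at_left b) \<phi>) \<and>
     (\<phi> \<longlongrightarrow> \<infinity>) at_top"

text \<open>
  As elements of $L^0$ are real valued, \<open>\<phi>(|x|) \<in> E\<close> includes that \<open>\<phi>(|x|)\<close> is finite a.e.; on the
  exceptional null set \<open>enn2real\<close> returns \<open>0\<close>.
\<close>

definition modular ::
    "'a measure \<Rightarrow> ('a \<Rightarrow> real) set \<Rightarrow> (('a \<Rightarrow> real) \<Rightarrow> real) \<Rightarrow> (real \<Rightarrow> ennreal) \<Rightarrow> ('a \<Rightarrow> real) \<Rightarrow> ennreal" where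
  "modular M E N \<phi> x =
     (if (AE t in M. \<phi> \<bar>x t\<bar> < \<infinity>) \<and> (\<lambda>t. enn2real (\<phi> \<bar>x t\<bar>)) \<in> E
      then ennreal (N (\<lambda>t. enn2real (\<phi> \<bar>x t\<bar>))) else \<infinity>)"

definition orlicz_space ::
    "'a measure \<Rightarrow> ('a \<Rightarrow> real) set \<Rightarrow> (('a \<Rightarrow> real) \<Rightarrow> real) \<Rightarrow> (real \<Rightarrow> ennreal) \<Rightarrow> ('a \<Rightarrow> real) set" where
  "orlicz_space M E N \<phi> =
     {x \<in> L0 M. ((\<lambda>r. modular M E N \<phi> (\<lambda>t. r * x t)) \<longlongrightarrow> 0) (at (0::real))}"

definition luxemburg ::
    "'a measure \<Rightarrow> ('a \<Rightarrow> real) set \<Rightarrow> (('a \<Rightarrow> real) \<Rightarrow> real) \<Rightarrow> (real \<Rightarrow> ennreal) \<Rightarrow> ('a \<Rightarrow> real) \<Rightarrow> real" where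
  "luxemburg M E N \<phi> x = Inf {r. 0 < r \<and> modular M E N \<phi> (\<lambda>t. x t / r) \<le> 1}"

definition alpha_index :: "(real \<Rightarrow> ennreal) \<Rightarrow> ereal" where
  "alpha_index \<phi> = Sup {ereal q | q :: real. \<exists>K :: real. K \<ge> 1 \<and>
     (\<forall>u \<ge> 0. \<forall>a. 0 < a \<and> a \<le> 1 \<longrightarrow> \<phi> (a * u) \<le> ennreal (K * a powr q) * \<phi> u)}"

end

theory Submission
  imports Defs
begin

text \<open>
  It suffices to find \<open>b > 1\<close> and \<open>c < 1\<close> with \<open>\<phi> (u / b) \<le> c * \<phi> u\<close> for all \<open>u\<close>: iterating
  such an estimate bounds \<open>\<phi> (a * u)\<close> by a positive power of \<open>a\<close> (lemma \<open>alpha_index_pos\<close>).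

  Let \<open>C\<close> be the constant of the quasi-norm and \<open>\<delta>\<close> the gain of uniform monotonicity for
  \<open>\<epsilon> = 1\<close>. Given \<open>u > 0\<close>, take disjoint sets \<open>A\<close>, \<open>B\<close> with \<open>N 1\<^sub>A = N 1\<^sub>B = 1 / \<phi> u\<close>. The functions
  \<open>x = u 1\<^sub>A\<close> and \<open>y = u 1\<^sub>B\<close> have modular \<open>1\<close>, hence norm at most \<open>1\<close>, so \<open>x + y\<close> has norm at
  most \<open>2 C\<close>. For \<open>b > 2 C\<close> this says that the modular of \<open>(x + y) / b\<close>, which is
  \<open>\<phi> (u / b) * N 1\<^bsub>A \<union> B\<^esub>\<close>, is at most \<open>1\<close>. But uniform monotonicity gives
  \<open>N 1\<^bsub>A \<union> B\<^esub> \<ge> (1 + \<delta>) / \<phi> u\<close>. Therefore \<open>\<phi> (u / b) \<le> \<phi> u / (1 + \<delta>)\<close>, where \<open>b\<close> and \<open>\<delta>\<close>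
  do not depend on \<open>u\<close>.

  What remains is that \<open>A \<mapsto> N 1\<^sub>A\<close> takes every value \<open>s \<ge> 0\<close>, on two disjoint sets
  (lemma \<open>disjoint_indicators_of_norm\<close>). Its values are unbounded because otherwise the Fatou
  property would give \<open>L\<^sub>\<infinity> \<subseteq> E\<close>. Uniform monotonicity makes it continuous from above at null sets
  (lemma \<open>indicator_order_continuous\<close>), and together with non-atomicity this yields an intermediate
  value theorem (lemma \<open>indicator_intermediate_value\<close>).
\<close>

section \<open>Norms of indicator functions\<close>

context p_normed_ideal_space
begin

lemma N_nonneg: "x \<in> E \<Longrightarrow> 0 \<le> N x"
  using p_norm by (auto simp: p_norm_on_def)

lemma N_cmult: "x \<in> E \<Longrightarrow> N (\<lambda>t. c * x t) = \<bar>c\<bar> * N x"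
  using p_norm by (auto simp: p_norm_on_def)

lemma cmult_mem: "x \<in> E \<Longrightarrow> (\<lambda>t. c * x t) \<in> E"
  using subspace by (auto simp: linear_subspace_def)

lemma add_mem: "x \<in> E \<Longrightarrow> y \<in> E \<Longrightarrow> (\<lambda>t. x t + y t) \<in> E"
  using subspace by (auto simp: linear_subspace_def)

lemma N_eq_0_iff: "x \<in> E \<Longrightarrow> N x = 0 \<longleftrightarrow> (AE t in M. x t = 0)"
  using p_norm by (auto simp: p_norm_on_def)

lemma N_add_powr: "x \<in> E \<Longrightarrow> y \<in> E \<Longrightarrow> N (\<lambda>t. x t + y t) powr p \<le> N x powr p + N y powr p"
  using p_norm by (auto simp: p_norm_on_def)

lemma indicator_subset:
  assumes "indicat_real A \<in> E" "B \<in> sets M" "B \<subseteq> A"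
  shows indicator_subset_mem: "indicat_real B \<in> E"
    and N_indicator_mono: "N (indicat_real B) \<le> N (indicat_real A)"
proof -
  have "AE t in M. \<bar>indicat_real B t\<bar> \<le> \<bar>indicat_real A t\<bar>"
    using assms(3) by (intro AE_I2) (auto simp: indicator_def)
  with ideal_norm[of "indicat_real B" "indicat_real A"] assms
  show "indicat_real B \<in> E" "N (indicat_real B) \<le> N (indicat_real A)"
    by auto
qed

lemma indicator_Un_disjoint:
  "A \<inter> B = {} \<Longrightarrow> indicat_real (A \<union> B) = (\<lambda>t. indicat_real A t + indicat_real B t)"
  by (auto simp: indicator_def fun_eq_iff)

lemma N_indicator_pos_iff:
  assumes "indicat_real A \<in> E" "A \<in> sets M"
  shows "0 < N (indicat_real A) \<longleftrightarrow> 0 < emeasure M A"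
proof -
  have "(AE t in M. indicat_real A t = 0) \<longleftrightarrow> emeasure M A = 0"
    using assms(2) by (subst AE_iff_measurable[of A]) (auto simp: indicator_def dest: sets.sets_into_space)
  then show ?thesis
    using N_eq_0_iff[OF assms(1)] N_nonneg[OF assms(1)] by (auto simp: zero_less_iff_neq_zero)
qed

text \<open>Uniform monotonicity is stated for \<open>x\<close> on the unit sphere; homogeneity removes the
  normalisation.\<close>

lemma uniformly_monotone_scaled:
  assumes "uniformly_monotone M E N" "0 < \<epsilon>"
  obtains \<delta> where "0 < \<delta>"
    and "\<And>x y. x \<in> positive_cone M E \<Longrightarrow> y \<in> positive_cone M E \<Longrightarrow> \<epsilon> * N x \<le> N y \<Longrightarrow>
           (1 + \<delta>) * N x \<le> N (\<lambda>t. x t + y t)"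
proof -
  from assms obtain \<delta> where \<delta>: "0 < \<delta>"
    and mono: "\<And>x y. x \<in> positive_cone M E \<Longrightarrow> y \<in> positive_cone M E \<Longrightarrow> N x = 1 \<Longrightarrow> \<epsilon> \<le> N y \<Longrightarrow>
           1 + \<delta> \<le> N (\<lambda>t. x t + y t)"
    unfolding uniformly_monotone_def by metis
  have "(1 + \<delta>) * N x \<le> N (\<lambda>t. x t + y t)"
    if x: "x \<in> positive_cone M E" and y: "y \<in> positive_cone M E" and le: "\<epsilon> * N x \<le> N y" for x y
  proof -
    have xE: "x \<in> E" and yE: "y \<in> E" and x0: "AE t in M. 0 \<le> x t" and y0: "AE t in M. 0 \<le> y t"
      using x y by (auto simp: positive_cone_def)
    show ?thesis
    proof (cases "N x = 0")
      case True
      then show ?thesis using N_nonneg[OF add_mem[OF xE yE]] by simp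
    next
      case False
      define c where "c = inverse (N x)"
      have c: "0 < c" and cN: "c * N x = 1"
        using False N_nonneg[OF xE] by (auto simp: c_def)
      have "1 + \<delta> \<le> N (\<lambda>t. c * x t + c * y t)"
      proof (rule mono)
        show "(\<lambda>t. c * x t) \<in> positive_cone M E"
          using x0 c by (auto simp: positive_cone_def cmult_mem[OF xE])
        show "(\<lambda>t. c * y t) \<in> positive_cone M E"
          using y0 c by (auto simp: positive_cone_def cmult_mem[OF yE])
        show "N (\<lambda>t. c * x t) = 1"
          using c cN by (simp add: N_cmult[OF xE])
        show "\<epsilon> \<le> N (\<lambda>t. c * y t)"
          using mult_left_mono[OF le, of c] c cN by (simp add: N_cmult[OF yE] mult.left_commute)
      qed
      also have "(\<lambda>t. c * x t + c * y t) = (\<lambda>t. c * (x t + y t))"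
        by (simp add: algebra_simps)
      also have "N \<dots> = c * N (\<lambda>t. x t + y t)"
        using c N_cmult[OF add_mem[OF xE yE]] by simp
      finally have "(1 + \<delta>) * N x \<le> (c * N (\<lambda>t. x t + y t)) * N x"
        using N_nonneg[OF xE] by (rule mult_right_mono)
      also have "\<dots> = (c * N x) * N (\<lambda>t. x t + y t)" by simp
      finally show ?thesis by (simp add: cN)
    qed
  qed
  then show thesis using that \<delta> by blast
qed

lemma indicator_positive_cone: "indicat_real A \<in> E \<Longrightarrow> indicat_real A \<in> positive_cone M E"
  by (auto simp: positive_cone_def)

text \<open>The Fatou property for indicators: continuity from below of the set function
  \<open>A \<mapsto> N 1\<^sub>A\<close>.\<close>

lemma fatou_indicator:
  assumes "fatou_property M E N" "\<And>n. indicat_real (B n) \<in> E" "incseq B"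
    and "A \<in> sets M" "AE t in M. t \<in> A \<longleftrightarrow> (\<exists>n. t \<in> B n)" "\<And>n. N (indicat_real (B n)) \<le> c"
  shows "indicat_real A \<in> E" and "(\<lambda>n. N (indicat_real (B n))) \<longlonglongrightarrow> N (indicat_real A)"
proof -
  have "AE t in M. (\<forall>n. 0 \<le> indicat_real (B n) t) \<and> incseq (\<lambda>n. indicat_real (B n) t) \<and>
      (\<lambda>n. indicat_real (B n) t) \<longlonglongrightarrow> \<bar>indicat_real A t\<bar>"
    using assms(5)
  proof eventually_elim
    case (elim t)
    have "incseq (\<lambda>n. indicat_real (B n) t)"
      using assms(3) by (auto simp: incseq_def indicator_def)
    moreover have "(\<lambda>n. indicat_real (B n) t) \<longlonglongrightarrow> indicat_real (\<Union>n. B n) t"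
      using LIMSEQ_indicator_incseq[OF assms(3)] .
    moreover have "indicat_real (\<Union>n. B n) t = \<bar>indicat_real A t\<bar>"
      using elim by (auto simp: indicator_def)
    ultimately show ?case by simp
  qed
  moreover have "bdd_above (range (\<lambda>n. N (indicat_real (B n))))"
    using assms(6) by (intro bdd_aboveI[of _ c]) auto
  ultimately have "indicat_real A \<in> E \<and> (\<lambda>n. N (indicat_real (B n))) \<longlonglongrightarrow> N (indicat_real A)"
    using assms(1,2,4) unfolding fatou_property_def
    by (elim allE[of _ "\<lambda>n. indicat_real (B n)"] allE[of _ "indicat_real A"]) auto
  then show "indicat_real A \<in> E" "(\<lambda>n. N (indicat_real (B n))) \<longlonglongrightarrow> N (indicat_real A)"
    by auto
qed

text \<open>Continuity from above comes from uniform monotonicity. If all \<open>N 1\<^bsub>C n\<^esub>\<close> stayed above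
  some \<open>\<epsilon> > 0\<close>, adding \<open>1\<^bsub>C n\<^esub>\<close> to \<open>1\<^bsub>C 0 - C n\<^esub>\<close> would increase the norm by a fixed factor
  \<open>1 + \<delta>\<close>, although by the Fatou property \<open>N 1\<^bsub>C 0 - C n\<^esub>\<close> already tends to \<open>N 1\<^bsub>C 0\<^esub>\<close>.\<close>

lemma indicator_order_continuous:
  assumes fatou: "fatou_property M E N" and um: "uniformly_monotone M E N"
    and C: "\<And>n. C n \<in> sets M" "decseq C" "indicat_real (C 0) \<in> E"
    and null: "AE t in M. \<exists>n. t \<notin> C n" and "0 < \<epsilon>"
  shows "\<exists>n. N (indicat_real (C n)) < \<epsilon>"
proof (rule ccontr)
  assume "\<not> ?thesis"
  then have ge: "\<epsilon> \<le> N (indicat_real (C n))" for n by (auto simp: not_less)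
  define R where "R = N (indicat_real (C 0))"
  have R: "0 < R" using ge[of 0] \<open>0 < \<epsilon>\<close> by (simp add: R_def)
  have sub: "C n \<subseteq> C 0" for n using C(2) by (auto simp: decseq_def)
  have CE: "indicat_real (C n) \<in> E" for n
    using indicator_subset_mem[OF C(3) C(1) sub] .
  have DE: "indicat_real (C 0 - C n) \<in> E" and DR: "N (indicat_real (C 0 - C n)) \<le> R" for n
    using indicator_subset[OF C(3), of "C 0 - C n"] C(1) by (auto simp: R_def)
  obtain \<delta> where \<delta>: "0 < \<delta>" and mono:
    "\<And>x y. x \<in> positive_cone M E \<Longrightarrow> y \<in> positive_cone M E \<Longrightarrow> (\<epsilon> / R) * N x \<le> N y \<Longrightarrow>
       (1 + \<delta>) * N x \<le> N (\<lambda>t. x t + y t)"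
    by (rule uniformly_monotone_scaled[OF um divide_pos_pos[OF \<open>0 < \<epsilon>\<close> R]]) (rule that)
  have "(1 + \<delta>) * N (indicat_real (C 0 - C n)) \<le> R" for n
  proof -
    have "(\<epsilon> / R) * N (indicat_real (C 0 - C n)) \<le> (\<epsilon> / R) * R"
      using DR[of n] R \<open>0 < \<epsilon>\<close> by (intro mult_left_mono) auto
    also have "\<dots> \<le> N (indicat_real (C n))" using R ge by simp
    finally have "(1 + \<delta>) * N (indicat_real (C 0 - C n))
        \<le> N (\<lambda>t. indicat_real (C 0 - C n) t + indicat_real (C n) t)"
      by (intro mono indicator_positive_cone CE DE)
    also have "(\<lambda>t. indicat_real (C 0 - C n) t + indicat_real (C n) t) = indicat_real (C 0)"
      using sub[of n] by (auto simp: indicator_def fun_eq_iff)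
    finally show ?thesis by (simp add: R_def)
  qed
  moreover have "(\<lambda>n. N (indicat_real (C 0 - C n))) \<longlonglongrightarrow> R"
    unfolding R_def
  proof (rule fatou_indicator(2)[OF fatou DE _ C(1) _ DR])
    show "incseq (\<lambda>n. C 0 - C n)" using C(2) by (auto simp: incseq_def decseq_def)
    show "AE t in M. t \<in> C 0 \<longleftrightarrow> (\<exists>n. t \<in> C 0 - C n)"
      using null by eventually_elim auto
  qed
  then have "(\<lambda>n. (1 + \<delta>) * N (indicat_real (C 0 - C n))) \<longlonglongrightarrow> (1 + \<delta>) * R"
    by (intro tendsto_intros)
  ultimately have "(1 + \<delta>) * R \<le> R"
    by (intro LIMSEQ_le_const2) auto
  then show False using mult_pos_pos[OF R \<delta>] by (simp add: algebra_simps)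
qed

end

section \<open>Small sets in a non-atomic measure space\<close>

lemma non_atomic_half:
  assumes "non_atomic M" "A \<in> sets M" "emeasure M A < \<infinity>" "0 < emeasure M A"
  shows "\<exists>B \<in> sets M. B \<subseteq> A \<and> 0 < emeasure M B \<and> measure M B \<le> measure M A / 2"
proof -
  obtain B where B: "B \<in> sets M" "B \<subseteq> A" "emeasure M B \<noteq> 0" "emeasure M (A - B) \<noteq> 0"
    using assms unfolding non_atomic_def atom_def by blast
  have "measure M (A - B) = measure M A - measure M B"
    using assms B by (intro measure_Diff) auto
  then consider "measure M B \<le> measure M A / 2" | "measure M (A - B) \<le> measure M A / 2"
    by linarith
  then show ?thesis
  proof cases
    case 1
    then show ?thesis using B by (intro bexI[of _ B]) (simp_all add: zero_less_iff_neq_zero)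
  next
    case 2
    then show ?thesis using B assms(2)
      by (intro bexI[of _ "A - B"]) (simp_all add: zero_less_iff_neq_zero Diff_subset)
  qed
qed

text \<open>Halving repeatedly, always keeping the smaller of the two non-null parts, gives non-null sets
  whose measure tends to \<open>0\<close>.\<close>

lemma non_atomic_shrinking_sequence:
  assumes "non_atomic M" "A \<in> sets M" "emeasure M A < \<infinity>" "0 < emeasure M A"
  obtains C :: "nat \<Rightarrow> 'a set" where "C 0 = A" "\<And>n. C n \<in> sets M" "decseq C"
    "\<And>n. 0 < emeasure M (C n)" "AE t in M. \<exists>n. t \<notin> C n"
proof -
  \<comment> \<open>the clause for \<open>n = 0\<close> makes the dependent choice start at \<open>A\<close>\<close>
  have "\<exists>C :: nat \<Rightarrow> 'a set. \<forall>n. (C n \<in> sets M \<and> C n \<subseteq> A \<and> 0 < emeasure M (C n) \<and> (n = 0 \<longrightarrow> C n = A)) \<and>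
      (C (Suc n) \<subseteq> C n \<and> measure M (C (Suc n)) \<le> measure M (C n) / 2)"
  proof (rule dependent_nat_choice)
    show "\<exists>B. B \<in> sets M \<and> B \<subseteq> A \<and> 0 < emeasure M B \<and> ((0::nat) = 0 \<longrightarrow> B = A)"
      using assms by blast
  next
    fix B n assume B: "B \<in> sets M \<and> B \<subseteq> A \<and> 0 < emeasure M B \<and> ((n::nat) = 0 \<longrightarrow> B = A)"
    then have "emeasure M B \<le> emeasure M A"
      using assms(2) by (intro emeasure_mono) simp_all
    then have "emeasure M B < \<infinity>" using assms(3) by (rule le_less_trans)
    then obtain B' where B': "B' \<in> sets M" "B' \<subseteq> B" "0 < emeasure M B'" "measure M B' \<le> measure M B / 2"
      using non_atomic_half[OF assms(1), of B] B by blast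
    then have "B' \<subseteq> A" using B by blast
    with B' show "\<exists>B'. (B' \<in> sets M \<and> B' \<subseteq> A \<and> 0 < emeasure M B' \<and> (Suc n = 0 \<longrightarrow> B' = A)) \<and>
      (B' \<subseteq> B \<and> measure M B' \<le> measure M B / 2)"
      by (intro exI[of _ B']) simp
  qed
  then obtain C :: "nat \<Rightarrow> 'a set" where
    C': "\<forall>n. (C n \<in> sets M \<and> C n \<subseteq> A \<and> 0 < emeasure M (C n) \<and> (n = 0 \<longrightarrow> C n = A)) \<and>
      (C (Suc n) \<subseteq> C n \<and> measure M (C (Suc n)) \<le> measure M (C n) / 2)" ..
  have C: "C n \<in> sets M" "C n \<subseteq> A" "0 < emeasure M (C n)" "C 0 = A" "C (Suc n) \<subseteq> C n"
    "measure M (C (Suc n)) \<le> measure M (C n) / 2" for n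
    using C' by blast+
  have fin: "emeasure M (C n) \<noteq> \<infinity>" for n
    using le_less_trans[OF emeasure_mono[OF C(2)[of n] assms(2)] assms(3)] by simp
  have "measure M (C n) \<le> measure M A * (1/2) ^ n" for n
  proof (induction n)
    case (Suc n) then show ?case using C(6)[of n] by simp
  qed (simp add: C(4))
  then have le: "\<forall>\<^sub>F n in sequentially. measure M (C n) \<le> measure M A * (1/2) ^ n"
    by (intro always_eventually allI)
  have "(\<lambda>n. measure M A * (1/2) ^ n) \<longlonglongrightarrow> 0"
    by (intro tendsto_mult_right_zero LIMSEQ_power_zero) simp
  from tendsto_sandwich[OF _ le tendsto_const this]
  have "(\<lambda>n. measure M (C n)) \<longlonglongrightarrow> 0" by simp
  moreover have "decseq C" using C(5) by (rule decseq_SucI)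
  moreover have "(\<lambda>n. measure M (C n)) \<longlonglongrightarrow> measure M (\<Inter>n. C n)"
    using C(1) \<open>decseq C\<close> fin by (intro Lim_measure_decseq) auto
  ultimately have "measure M (\<Inter>n. C n) = 0" by (metis LIMSEQ_unique)
  moreover have "emeasure M (\<Inter>n. C n) \<le> emeasure M (C 0)"
    using C(1) by (intro emeasure_mono) blast+
  then have "emeasure M (\<Inter>n. C n) \<noteq> \<infinity>"
    using fin[of 0] neq_top_trans[of "emeasure M (C 0)"] by simp
  ultimately have "emeasure M (\<Inter>n. C n) = 0"
    by (simp add: emeasure_eq_ennreal_measure)
  then have "(\<Inter>n. C n) \<in> null_sets M"
    using C(1) by (intro null_setsI) auto
  from AE_not_in[OF this] have "AE t in M. \<exists>n. t \<notin> C n" by simp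
  with C(4,1) \<open>decseq C\<close> C(3) show thesis by (rule that)
qed

section \<open>Indicators of prescribed norm\<close>

context p_normed_ideal_space
begin

text \<open>Grow a set greedily below the bound \<open>s\<close>, each time coming close to the largest norm that can
  still be reached by enlarging it; the union is maximal, and the Fatou property keeps its norm
  below \<open>s\<close>.\<close>

lemma maximal_indicator_below:
  assumes fatou: "fatou_property M E N" and A: "A \<in> sets M" "indicat_real A \<in> E" and "0 \<le> s"
  obtains B where "B \<in> sets M" "B \<subseteq> A" "N (indicat_real B) \<le> s"
    "\<And>D. D \<in> sets M \<Longrightarrow> B \<subseteq> D \<Longrightarrow> D \<subseteq> A \<Longrightarrow> N (indicat_real D) \<le> s \<Longrightarrow>
       N (indicat_real D) \<le> N (indicat_real B)"
proof -
  define K where "K = {D \<in> sets M. D \<subseteq> A \<and> N (indicat_real D) \<le> s}"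
  have KE: "D \<in> K \<Longrightarrow> indicat_real D \<in> E" for D
    using indicator_subset_mem[OF A(2)] by (auto simp: K_def)
  have "N (indicat_real {}) = 0"
    using N_eq_0_iff[of "indicat_real {}"] indicator_subset_mem[OF A(2), of "{}"] by simp
  then have empty: "{} \<in> K" using \<open>0 \<le> s\<close> by (auto simp: K_def)
  \<comment> \<open>the tolerance \<open>1 / Suc n\<close> of the \<open>n\<close>th step could be any null sequence\<close>
  have step: "\<exists>D'. D' \<in> K \<and> D \<subseteq> D' \<and>
      (\<forall>G \<in> K. D \<subseteq> G \<longrightarrow> N (indicat_real G) \<le> N (indicat_real D') + 1 / real (Suc n))"
    if "D \<in> K" for D n
  proof -
    define V where "V = (\<lambda>G. N (indicat_real G)) ` {G \<in> K. D \<subseteq> G}"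
    have "V \<noteq> {}" "bdd_above V" using that by (auto simp: V_def K_def intro!: bdd_aboveI[of _ s])
    then have "\<exists>v\<in>V. Sup V - 1 / real (Suc n) < v"
      by (intro less_cSupD) auto
    then obtain D' where D': "D' \<in> K" "D \<subseteq> D'" "Sup V - 1 / real (Suc n) < N (indicat_real D')"
      by (auto simp: V_def)
    moreover have "N (indicat_real G) \<le> Sup V" if "G \<in> K" "D \<subseteq> G" for G
      using \<open>bdd_above V\<close> that by (intro cSup_upper) (auto simp: V_def)
    ultimately show ?thesis by (intro exI[of _ D']) force
  qed
  have "\<exists>G :: nat \<Rightarrow> 'a set. \<forall>n. G n \<in> K \<and> (G n \<subseteq> G (Suc n) \<and>
      (\<forall>D \<in> K. G n \<subseteq> D \<longrightarrow> N (indicat_real D) \<le> N (indicat_real (G (Suc n))) + 1 / real (Suc n)))"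
  proof (rule dependent_nat_choice)
    show "\<exists>D. D \<in> K" using empty by (rule exI)
  qed (rule step)
  then obtain G :: "nat \<Rightarrow> 'a set" where G: "\<And>n. G n \<in> K" "\<And>n. G n \<subseteq> G (Suc n)"
    "\<And>n D. D \<in> K \<Longrightarrow> G n \<subseteq> D \<Longrightarrow> N (indicat_real D) \<le> N (indicat_real (G (Suc n))) + 1 / real (Suc n)"
    by metis
  have "incseq G" using G(2) by (rule incseq_SucI)
  define B where "B = (\<Union>n. G n)"
  have B: "B \<in> sets M" "B \<subseteq> A" using G(1) by (auto simp: B_def K_def)
  have lim: "(\<lambda>n. N (indicat_real (G n))) \<longlonglongrightarrow> N (indicat_real B)"
    using G(1) \<open>incseq G\<close> by (intro fatou_indicator(2)[OF fatou KE _ B(1), of _ s]) (auto simp: B_def K_def)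
  show thesis
  proof (rule that[OF B])
    show "N (indicat_real B) \<le> s"
      using G(1) by (intro LIMSEQ_le_const2[OF lim]) (auto simp: K_def)
    fix D assume D: "D \<in> sets M" "B \<subseteq> D" "D \<subseteq> A" "N (indicat_real D) \<le> s"
    have "(\<lambda>n. N (indicat_real (G (Suc n))) + 1 / real (Suc n)) \<longlonglongrightarrow> N (indicat_real B) + 0"
      using LIMSEQ_Suc[OF lim] LIMSEQ_Suc[OF lim_1_over_n] by (intro tendsto_add) auto
    moreover have "N (indicat_real D) \<le> N (indicat_real (G (Suc n))) + 1 / real (Suc n)" for n
      using D by (intro G(3)) (auto simp: K_def B_def)
    ultimately show "N (indicat_real D) \<le> N (indicat_real B)"
      using LIMSEQ_le_const[of _ "N (indicat_real B) + 0" "N (indicat_real D)"] by auto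
  qed
qed

text \<open>The intermediate value property of \<open>A \<mapsto> N 1\<^sub>A\<close>. If a maximal set \<open>B\<close> had norm below \<open>s\<close>,
  then \<open>A - B\<close> would not be null, and by non-atomicity and order continuity it would contain a
  non-null set so small that \<open>B\<close> can be enlarged by it without exceeding \<open>s\<close>; uniform monotonicity
  makes this a strict increase.\<close>

lemma indicator_intermediate_value:
  assumes fatou: "fatou_property M E N" and um: "uniformly_monotone M E N"
    and na: "non_atomic M" and p: "0 < p"
    and A: "A \<in> sets M" "emeasure M A < \<infinity>" "indicat_real A \<in> E" and s: "0 \<le> s" "s \<le> N (indicat_real A)"
  obtains B where "B \<in> sets M" "B \<subseteq> A" "N (indicat_real B) = s"
proof -
  obtain B where B: "B \<in> sets M" "B \<subseteq> A" "N (indicat_real B) \<le> s"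
    and max: "\<And>D. D \<in> sets M \<Longrightarrow> B \<subseteq> D \<Longrightarrow> D \<subseteq> A \<Longrightarrow> N (indicat_real D) \<le> s \<Longrightarrow>
       N (indicat_real D) \<le> N (indicat_real B)"
    using maximal_indicator_below[OF fatou A(1,3) s(1)] by blast
  define \<nu> where "\<nu> = (\<lambda>D. N (indicat_real D))"
  have BE: "indicat_real B \<in> E" using indicator_subset_mem[OF A(3) B(1,2)] .
  have \<nu>_Un: "\<nu> (B \<union> D) powr p \<le> \<nu> B powr p + \<nu> D powr p"
    if "D \<in> sets M" "D \<subseteq> A - B" for D
  proof -
    have "B \<inter> D = {}" "indicat_real D \<in> E"
      using that(2) indicator_subset_mem[OF A(3) that(1)] by auto
    then show ?thesis
      using N_add_powr[OF BE] by (simp add: \<nu>_def indicator_Un_disjoint)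
  qed
  have "\<nu> B = s"
  proof (rule ccontr)
    assume "\<nu> B \<noteq> s"
    then have less: "\<nu> B < s" using B(3) by (simp add: \<nu>_def)
    have B0: "0 \<le> \<nu> B" using N_nonneg[OF BE] by (simp add: \<nu>_def)
    have ABE: "indicat_real (A - B) \<in> E" using indicator_subset_mem[OF A(3), of "A - B"] A(1) B(1) by auto
    have gap: "\<nu> B powr p < s powr p" using less B0 p by (intro powr_less_mono2) auto
    have "0 < \<nu> (A - B)"
    proof (rule ccontr)
      assume "\<not> 0 < \<nu> (A - B)"
      then have "\<nu> (A - B) = 0" using N_nonneg[OF ABE] by (simp add: \<nu>_def)
      then have "\<nu> (B \<union> (A - B)) powr p \<le> \<nu> B powr p"
        using \<nu>_Un[of "A - B"] A(1) B(1) by simp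
      moreover have "B \<union> (A - B) = A" using B(2) by auto
      moreover have "s powr p \<le> \<nu> A powr p" using s p by (intro powr_mono2) (auto simp: \<nu>_def)
      ultimately show False using gap by simp
    qed
    then have "0 < emeasure M (A - B)"
      using N_indicator_pos_iff[OF ABE] A(1) B(1) by (auto simp: \<nu>_def)
    moreover have "emeasure M (A - B) < \<infinity>"
      by (rule le_less_trans[OF emeasure_mono[OF Diff_subset A(1)] A(2)])
    ultimately obtain C where C: "C 0 = A - B" "\<And>n. C n \<in> sets M" "decseq C"
        "\<And>n. 0 < emeasure M (C n)" "AE t in M. \<exists>n. t \<notin> C n"
      using non_atomic_shrinking_sequence[OF na, of "A - B"] A(1) B(1) by blast
    \<comment> \<open>chosen so that \<open>p\<close>-subadditivity keeps \<open>B\<close> enlarged by a set of norm below \<open>\<epsilon>\<close> within \<open>s\<close>\<close>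
    define \<epsilon> where "\<epsilon> = (s powr p - \<nu> B powr p) powr (1 / p)"
    have \<epsilon>: "0 < \<epsilon>" "\<epsilon> powr p = s powr p - \<nu> B powr p"
      using gap p by (auto simp: \<epsilon>_def powr_powr)
    obtain n where n: "\<nu> (C n) < \<epsilon>"
      using indicator_order_continuous[OF fatou um C(2,3) _ C(5) \<epsilon>(1)] ABE C(1) by (auto simp: \<nu>_def)
    have sub: "C n \<subseteq> A - B" using C(1,3) by (auto simp: decseq_def)
    have CE: "indicat_real (C n) \<in> E" using indicator_subset_mem[OF ABE C(2) sub] .
    have C0: "0 < \<nu> (C n)" using C(4) N_indicator_pos_iff[OF CE C(2)] by (simp add: \<nu>_def)
    have UE: "indicat_real (B \<union> C n) \<in> E"
      using indicator_subset_mem[OF A(3), of "B \<union> C n"] B(1,2) C(2) sub by auto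
    have "\<nu> (B \<union> C n) powr p \<le> \<nu> B powr p + \<epsilon> powr p"
      using \<nu>_Un[OF C(2) sub] powr_mono2[of p "\<nu> (C n)" \<epsilon>] C0 n p by auto
    then have "\<nu> (B \<union> C n) powr p \<le> s powr p" by (simp add: \<epsilon>)
    then have "\<nu> (B \<union> C n) \<le> s"
      using p s(1) powr_less_mono2[of p s "\<nu> (B \<union> C n)"] by force
    then have le: "\<nu> (B \<union> C n) \<le> \<nu> B"
      using max[of "B \<union> C n"] B(1,2) C(2) sub by (auto simp: \<nu>_def)
    have "0 < \<nu> B"
    proof (rule ccontr)
      assume "\<not> 0 < \<nu> B"
      then have "\<nu> (B \<union> C n) \<le> 0" using le by simp
      moreover have "\<nu> (C n) \<le> \<nu> (B \<union> C n)"
        using N_indicator_mono[OF UE C(2)] by (simp add: \<nu>_def)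
      ultimately show False using C0 by simp
    qed
    obtain \<delta> where \<delta>: "0 < \<delta>" and mono:
      "\<And>x y. x \<in> positive_cone M E \<Longrightarrow> y \<in> positive_cone M E \<Longrightarrow> (\<nu> (C n) / \<nu> B) * N x \<le> N y \<Longrightarrow>
         (1 + \<delta>) * N x \<le> N (\<lambda>t. x t + y t)"
      by (rule uniformly_monotone_scaled[OF um divide_pos_pos[OF C0 \<open>0 < \<nu> B\<close>]]) (rule that)
    have "B \<inter> C n = {}" using sub by auto
    then have "(1 + \<delta>) * \<nu> B \<le> \<nu> (B \<union> C n)"
      using mono[OF indicator_positive_cone[OF BE] indicator_positive_cone[OF CE]] \<open>0 < \<nu> B\<close>
      by (simp add: \<nu>_def indicator_Un_disjoint)
    then have "\<nu> B + \<delta> * \<nu> B \<le> \<nu> B" using le by (simp add: distrib_right)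
    then show False using mult_pos_pos[OF \<delta> \<open>0 < \<nu> B\<close>] by linarith
  qed
  then show thesis using that B by (auto simp: \<nu>_def)
qed

text \<open>Exhaust the space by sets of finite measure on which a strictly positive element of \<open>E\<close>
  exceeds \<open>1 / Suc n\<close>; their indicators lie in \<open>E\<close>. If the norms of indicators were bounded, the
  Fatou property would put the constant \<open>1\<close>, hence all of \<open>L\<^sub>\<infinity>\<close>, into \<open>E\<close>.\<close>

lemma indicator_unbounded:
  assumes fatou: "fatou_property M E N" and sf: "sigma_finite_measure M" and "\<not> Linfty M \<subseteq> E"
  obtains A where "A \<in> sets M" "emeasure M A < \<infinity>" "indicat_real A \<in> E" "R < N (indicat_real A)"
proof (rule ccontr)
  note unbounded = that
  assume "\<not> thesis"
  have bound: "N (indicat_real A) \<le> R"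
    if "A \<in> sets M" "emeasure M A < \<infinity>" "indicat_real A \<in> E" for A
  proof (rule leI, rule notI)
    assume "R < N (indicat_real A)"
    then have thesis by (rule unbounded[OF that])
    with \<open>\<not> thesis\<close> show False by (rule notE)
  qed
  obtain w where w: "w \<in> E" "AE t in M. 0 < w t" using strictly_positive by blast
  have wM[measurable]: "w \<in> borel_measurable M" using w(1) subset_L0 by auto
  obtain F :: "nat \<Rightarrow> 'a set" where F: "range F \<subseteq> sets M" "(\<Union>i. F i) = space M" "\<And>i. emeasure M (F i) \<noteq> \<infinity>" "incseq F"
    using sigma_finite_measure.sigma_finite_incseq[OF sf] by blast
  define S where "S = (\<lambda>n. F n \<inter> {t \<in> space M. 1 / real (Suc n) < w t})"
  have SM: "S n \<in> sets M" for n using F(1) by (auto simp: S_def)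
  have Sfin: "emeasure M (S n) < \<infinity>" for n
  proof (rule le_less_trans)
    show "emeasure M (S n) \<le> emeasure M (F n)"
      using F(1) by (intro emeasure_mono) (auto simp: S_def)
    show "emeasure M (F n) < \<infinity>" using F(3)[of n] by (simp add: less_top)
  qed
  have SE: "indicat_real (S n) \<in> E" for n
  proof -
    have "\<bar>indicat_real (S n) t\<bar> \<le> \<bar>real (Suc n) * w t\<bar>" for t
    proof (cases "t \<in> S n")
      case True
      then have "1 / real (Suc n) < w t" by (simp add: S_def)
      then have "1 \<le> real (Suc n) * w t" by (simp add: field_simps)
      then show ?thesis using True by simp
    qed simp
    then show ?thesis
      using ideal_norm[OF borel_measurable_indicator[OF SM] cmult_mem[OF w(1)]] by blast
  qed
  have incS: "incseq S"
    unfolding incseq_def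
  proof (intro allI impI subsetI)
    fix m n :: nat and t assume "m \<le> n" "t \<in> S m"
    moreover from \<open>m \<le> n\<close> have "1 / real (Suc n) \<le> 1 / real (Suc m)"
      by (intro divide_left_mono) auto
    ultimately show "t \<in> S n" using F(4) by (auto simp: S_def incseq_def)
  qed
  have "AE t in M. t \<in> space M \<longleftrightarrow> (\<exists>n. t \<in> S n)"
    using w(2) AE_space
  proof eventually_elim
    case (elim t)
    obtain i where i: "t \<in> F i" using elim F(2) by blast
    obtain j where j: "1 / real (Suc j) < w t" using reals_Archimedean[OF elim(1)] unfolding inverse_eq_divide by blast
    define k where "k = max i j"
    have "1 / real (Suc k) \<le> 1 / real (Suc j)" by (intro divide_left_mono) (auto simp: k_def)
    then have "1 / real (Suc k) < w t" using j by (rule le_less_trans)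
    moreover have "F i \<subseteq> F k" using F(4) by (rule incseqD) (simp add: k_def)
    ultimately have "t \<in> S k" using i elim(2) unfolding S_def by blast
    then show ?case using elim(2) by blast
  qed
  then have "indicat_real (space M) \<in> E"
    using sets.top by (intro fatou_indicator(1)[OF fatou SE incS _ _ bound[OF SM Sfin SE]])
  then have "x \<in> E" if "x \<in> Linfty M" for x
  proof -
    from that obtain c where xc: "x \<in> L0 M" "AE t in M. \<bar>x t\<bar> \<le> c" by (auto simp: Linfty_def)
    from xc(2) AE_space have "AE t in M. \<bar>x t\<bar> \<le> \<bar>c * indicat_real (space M) t\<bar>"
      by eventually_elim auto
    then show ?thesis
      using ideal_norm[OF xc(1) cmult_mem[OF \<open>indicat_real (space M) \<in> E\<close>], of c] by simp
  qed
  then show False using \<open>\<not> Linfty M \<subseteq> E\<close> by blast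
qed

text \<open>Start from a set \<open>T\<close> with \<open>(N 1\<^sub>T) powr p > 2 * s powr p\<close> and cut off \<open>A \<subseteq> T\<close> with
  \<open>N 1\<^sub>A = s\<close>; by \<open>p\<close>-subadditivity \<open>T - A\<close> still has norm at least \<open>s\<close>, which leaves room for
  \<open>B\<close>.\<close>

lemma disjoint_indicators_of_norm:
  assumes fatou: "fatou_property M E N" and um: "uniformly_monotone M E N"
    and na: "non_atomic M" and sf: "sigma_finite_measure M" and nL: "\<not> Linfty M \<subseteq> E"
    and p: "0 < p" and s: "0 \<le> s"
  obtains A B where "A \<inter> B = {}" "indicat_real A \<in> E" "indicat_real B \<in> E"
    "N (indicat_real A) = s" "N (indicat_real B) = s"
proof -
  obtain T where T: "T \<in> sets M" "emeasure M T < \<infinity>" "indicat_real T \<in> E"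
    and big: "max s ((2 * s powr p) powr (1 / p)) < N (indicat_real T)"
    using indicator_unbounded[OF fatou sf nL] by blast
  obtain A where A: "A \<in> sets M" "A \<subseteq> T" "N (indicat_real A) = s"
    using indicator_intermediate_value[OF fatou um na p T s] big by auto
  have AE: "indicat_real A \<in> E" using indicator_subset_mem[OF T(3) A(1,2)] .
  have D: "T - A \<in> sets M" using A T by auto
  have DE: "indicat_real (T - A) \<in> E" using indicator_subset_mem[OF T(3) D] by auto
  have Dfin: "emeasure M (T - A) < \<infinity>"
    by (rule le_less_trans[OF emeasure_mono[OF Diff_subset T(1)] T(2)])
  have TU: "A \<union> (T - A) = T" using A(2) by auto
  have "s \<le> N (indicat_real (T - A))"
  proof (rule ccontr)
    assume "\<not> ?thesis"
    then have "N (indicat_real (T - A)) powr p \<le> s powr p"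
      using p N_nonneg[OF DE] by (intro powr_mono2) auto
    moreover have "N (indicat_real T) powr p \<le> s powr p + N (indicat_real (T - A)) powr p"
      using N_add_powr[OF AE DE] indicator_Un_disjoint[of A "T - A"] TU A(3) by simp
    moreover have "((2 * s powr p) powr (1 / p)) powr p < N (indicat_real T) powr p"
      using big p by (intro powr_less_mono2) auto
    ultimately show False using p by (simp add: powr_powr)
  qed
  then obtain B where B: "B \<in> sets M" "B \<subseteq> T - A" "N (indicat_real B) = s"
    using indicator_intermediate_value[OF fatou um na p D Dfin DE s] by blast
  show thesis
    using that[of A B] A(3) B(2,3) AE indicator_subset_mem[OF DE B(1,2)] by auto
qed

end

section \<open>The Luxemburg functional on multiples of indicators\<close>

locale finite_orlicz_ideal_space = p_normed_ideal_space +
  fixes \<phi> :: "real \<Rightarrow> ennreal"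
  assumes orlicz: "orlicz_function \<phi>"
    and phi_finite: "\<And>u. 0 \<le> u \<Longrightarrow> \<phi> u < \<infinity>"
begin

definition phi_real :: "real \<Rightarrow> real" where "phi_real u = enn2real (\<phi> u)"

lemma ennreal_phi_real: "0 \<le> u \<Longrightarrow> ennreal (phi_real u) = \<phi> u"
  using phi_finite[of u] by (simp add: phi_real_def)

lemma phi_real_nonneg: "0 \<le> phi_real u"
  by (simp add: phi_real_def)

lemma phi_real_mono: "0 \<le> u \<Longrightarrow> u \<le> v \<Longrightarrow> phi_real u \<le> phi_real v"
  using orlicz phi_finite unfolding phi_real_def orlicz_function_def mono_on_def
  by (intro enn2real_mono) auto

lemma modular_indicator:
  assumes "indicat_real A \<in> E"
  shows "modular M E N \<phi> (\<lambda>t. v * indicat_real A t) = ennreal (phi_real \<bar>v\<bar> * N (indicat_real A))"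
proof -
  have \<phi>0: "\<phi> 0 = 0" using orlicz by (simp add: orlicz_function_def)
  have eq: "(\<lambda>t. enn2real (\<phi> \<bar>v * indicat_real A t\<bar>)) = (\<lambda>t. phi_real \<bar>v\<bar> * indicat_real A t)"
    by (auto simp: phi_real_def indicator_def fun_eq_iff \<phi>0)
  show ?thesis
    using phi_finite cmult_mem[OF assms] N_cmult[OF assms, of "phi_real \<bar>v\<bar>"] phi_real_nonneg[of "\<bar>v\<bar>"]
    unfolding modular_def eq by simp
qed

lemma indicator_mem_orlicz_space:
  assumes "indicat_real A \<in> E" "0 < u"
  shows "(\<lambda>t. u * indicat_real A t) \<in> orlicz_space M E N \<phi>"
proof -
  have "((\<lambda>r. \<phi> \<bar>r * u\<bar>) \<longlongrightarrow> 0) (at 0)"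
  proof (rule filterlim_compose[of \<phi> _ "at_right 0"])
    show "(\<phi> \<longlongrightarrow> 0) (at_right 0)"
      using orlicz unfolding orlicz_function_def continuous_within by metis
    have "((\<lambda>r. \<bar>r * u\<bar>) \<longlongrightarrow> \<bar>0 * u\<bar>) (at 0)" by (intro tendsto_intros)
    then show "filterlim (\<lambda>r. \<bar>r * u\<bar>) (at_right 0) (at 0)"
      unfolding filterlim_at using assms(2) by (auto simp: eventually_at_filter)
  qed
  then have "((\<lambda>r. ennreal (N (indicat_real A)) * \<phi> \<bar>r * u\<bar>) \<longlongrightarrow> ennreal (N (indicat_real A)) * 0) (at 0)"
    by (intro ennreal_tendsto_cmult) auto
  moreover have "modular M E N \<phi> (\<lambda>t. r * (u * indicat_real A t)) = ennreal (N (indicat_real A)) * \<phi> \<bar>r * u\<bar>" for r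
    using modular_indicator[OF assms(1), of "r * u"] N_nonneg[OF assms(1)]
    by (simp add: mult.assoc ennreal_mult phi_real_nonneg ennreal_phi_real mult.commute)
  moreover have "(\<lambda>t. u * indicat_real A t) \<in> L0 M" using cmult_mem[OF assms(1), of u] subset_L0 by auto
  ultimately show ?thesis by (simp add: orlicz_space_def)
qed

lemma modular_indicator_divide_le_1_iff:
  assumes "indicat_real A \<in> E" "0 < u" "0 < r"
  shows "modular M E N \<phi> (\<lambda>t. (u * indicat_real A t) / r) \<le> 1 \<longleftrightarrow> phi_real (u / r) * N (indicat_real A) \<le> 1"
  using modular_indicator[OF assms(1), of "u / r"] assms(2,3) by simp

lemma luxemburg_indicator_le:
  assumes "indicat_real A \<in> E" "0 < u" "0 < r" "phi_real (u / r) * N (indicat_real A) \<le> 1"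
  shows "luxemburg M E N \<phi> (\<lambda>t. u * indicat_real A t) \<le> r"
  unfolding luxemburg_def
  using assms by (intro cInf_lower bdd_belowI[of _ 0]) (auto simp: modular_indicator_divide_le_1_iff)

text \<open>The infimum in the Luxemburg functional is only informative because some \<open>r\<close> is admissible at
  all: the modular of \<open>r' * u 1\<^sub>A\<close> tends to \<open>0\<close> with \<open>r'\<close>. Admissibility then passes from some
  \<open>q < r\<close> to \<open>r\<close> since \<open>\<phi>\<close> is increasing.\<close>

lemma modular_le_1_if_luxemburg_less:
  assumes A: "indicat_real A \<in> E" "0 < u" and less: "luxemburg M E N \<phi> (\<lambda>t. u * indicat_real A t) < r"
  shows "phi_real (u / r) * N (indicat_real A) \<le> 1"
proof -
  let ?S = "{r. 0 < r \<and> modular M E N \<phi> (\<lambda>t. (u * indicat_real A t) / r) \<le> 1}"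
  have "((\<lambda>r. modular M E N \<phi> (\<lambda>t. r * (u * indicat_real A t))) \<longlongrightarrow> 0) (at_right 0)"
    using indicator_mem_orlicz_space[OF A] by (auto simp: orlicz_space_def filterlim_at_split)
  then have "eventually (\<lambda>r. modular M E N \<phi> (\<lambda>t. r * (u * indicat_real A t)) < 1) (at_right 0)"
    by (rule order_tendstoD) simp
  moreover have "eventually (\<lambda>r::real. 0 < r) (at_right 0)" by (simp add: eventually_at_right_less)
  ultimately have "eventually (\<lambda>r. 0 < r \<and> modular M E N \<phi> (\<lambda>t. r * (u * indicat_real A t)) < 1) (at_right 0)"
    by eventually_elim simp
  then obtain r' where "0 < r'" "modular M E N \<phi> (\<lambda>t. r' * (u * indicat_real A t)) < 1"
    using eventually_happens' trivial_limit_at_right_real by blast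
  then have "1 / r' \<in> ?S" by (simp add: mult.commute less_imp_le)
  then have "?S \<noteq> {}" by blast
  then have "\<exists>q\<in>?S. q < r"
    by (rule cInf_lessD) (use less in \<open>simp add: luxemburg_def\<close>)
  then obtain q where q: "q \<in> ?S" "q < r" by blast
  then have "phi_real (u / q) * N (indicat_real A) \<le> 1"
    using modular_indicator_divide_le_1_iff[OF A] by auto
  moreover have "phi_real (u / r) \<le> phi_real (u / q)"
    using q A(2) by (intro phi_real_mono divide_left_mono) auto
  ultimately show ?thesis
    using mult_right_mono[of "phi_real (u / r)" "phi_real (u / q)"] N_nonneg[OF A(1)] by fastforce
qed

end

section \<open>The lower index\<close>

text \<open>A uniform decay of \<open>\<phi>\<close> under one dilation iterates to a power estimate: with \<open>b powr -q = c\<close>,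
  an \<open>a\<close> lying between \<open>b ^ -(k+1)\<close> and \<open>b ^ -k\<close> gives
  \<open>\<phi> (a u) \<le> c ^ k * \<phi> u \<le> b powr q * a powr q * \<phi> u\<close>.\<close>

lemma alpha_index_pos:
  assumes mono: "mono_on {0..} \<phi>" and b: "1 < b" and c: "0 < c" "c < 1"
    and decay: "\<And>u. 0 \<le> u \<Longrightarrow> \<phi> (u / b) \<le> ennreal c * \<phi> u"
  shows "alpha_index \<phi> > 0"
proof -
  define q where "q = - log b c"
  have q: "0 < q" using b c by (simp add: q_def log_less_zero_cancel_iff)
  have bq: "b powr - q = c" using b c by (simp add: q_def)
  have iter: "\<phi> (u / b ^ k) \<le> ennreal (c ^ k) * \<phi> u" if "0 \<le> u" for u k
  proof (induction k)
    case (Suc k)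
    have "\<phi> (u / b ^ Suc k) \<le> ennreal c * \<phi> (u / b ^ k)"
      using decay[of "u / b ^ k"] that b by (simp add: mult.commute)
    also have "\<dots> \<le> ennreal c * (ennreal (c ^ k) * \<phi> u)" by (intro mult_left_mono Suc) auto
    finally show ?case using c by (simp add: ennreal_mult mult.assoc)
  qed simp
  have "\<phi> (a * u) \<le> ennreal (b powr q * a powr q) * \<phi> u" if u: "0 \<le> u" and a: "0 < a" "a \<le> 1" for u a
  proof -
    define k where "k = nat \<lfloor>- log b a\<rfloor>"
    have "0 \<le> - log b a" using a b by simp
    then have k: "real k \<le> - log b a" "- log b a < real k + 1"
      unfolding k_def by linarith+
    have ab: "a = b powr (log b a)" using a b by simp
    have "a \<le> b powr - real k" using k(1) b by (subst ab) (intro powr_mono, auto)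
    then have "a \<le> 1 / b ^ k" using b by (simp add: powr_minus powr_realpow divide_simps)
    then have "a * u \<le> u / b ^ k" using mult_right_mono[OF _ u] by fastforce
    then have "\<phi> (a * u) \<le> \<phi> (u / b ^ k)"
      using mono u a b by (auto simp: mono_on_def)
    also have "\<dots> \<le> ennreal (c ^ k) * \<phi> u" by (rule iter[OF u])
    also have "c ^ k \<le> b powr q * a powr q"
    proof -
      have "c ^ k = b powr (- q * real k)"
        using b by (simp add: bq[symmetric] powr_powr flip: powr_realpow)
      also have "\<dots> \<le> b powr (q + q * log b a)"
      proof (intro powr_mono)
        have "q * (- log b a) \<le> q * (real k + 1)" using k q by (intro mult_left_mono) auto
        then show "- q * real k \<le> q + q * log b a" by (simp add: algebra_simps)
      qed (use b in simp)
      also have "\<dots> = b powr q * a powr q"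
        using b by (subst (2) ab) (simp add: powr_add powr_powr mult.commute)
      finally show ?thesis .
    qed
    then have "ennreal (c ^ k) * \<phi> u \<le> ennreal (b powr q * a powr q) * \<phi> u"
      by (intro mult_right_mono ennreal_leI) auto
    finally show ?thesis .
  qed
  moreover have "1 \<le> b powr q" using b q by (simp add: ge_one_powr_ge_zero)
  ultimately have "ereal q \<le> alpha_index \<phi>"
    unfolding alpha_index_def by (intro Sup_upper) blast
  then show ?thesis using q by (metis ereal_less(2) less_le_trans)
qed

theorem theorem4p18:
  fixes M :: "'a measure" and E :: "('a \<Rightarrow> real) set" and N :: "('a \<Rightarrow> real) \<Rightarrow> real"
    and \<phi> :: "real \<Rightarrow> ennreal" and p :: real
  assumes "complete_measure M" and "sigma_finite_measure M" and "emeasure M (space M) > 0"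
    and "non_atomic M"
    and "orlicz_function \<phi>" and "\<forall>u \<ge> 0. \<phi> u < \<infinity>" and "strict_mono_on {0..} \<phi>"
    and "0 < p" and "p \<le> 1" and "p_normed_ideal_space M p E N"
    and "complete_space_on E N" and "fatou_property M E N" and "uniformly_monotone M E N"
    and "\<not> Linfty M \<subseteq> E" and "\<not> E \<subseteq> Linfty M"
    and "quasi_norm_on M (orlicz_space M E N \<phi>) (luxemburg M E N \<phi>)"
  shows "alpha_index \<phi> > 0"
proof -
  interpret finite_orlicz_ideal_space M p E N \<phi>
    using assms(5,6,10) by (simp add: finite_orlicz_ideal_space_def finite_orlicz_ideal_space_axioms_def)
  have mono: "mono_on {0..} \<phi>" and \<phi>0: "\<phi> 0 = 0" using assms(5) by (auto simp: orlicz_function_def)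
  obtain C where C: "1 \<le> C" and quasi: "\<And>x y. x \<in> orlicz_space M E N \<phi> \<Longrightarrow> y \<in> orlicz_space M E N \<phi> \<Longrightarrow>
      luxemburg M E N \<phi> (\<lambda>t. x t + y t) \<le> C * (luxemburg M E N \<phi> x + luxemburg M E N \<phi> y)"
    using assms(16) unfolding quasi_norm_on_def by blast
  obtain \<delta> where \<delta>: "0 < \<delta>" and um:
    "\<And>x y. x \<in> positive_cone M E \<Longrightarrow> y \<in> positive_cone M E \<Longrightarrow> 1 * N x \<le> N y \<Longrightarrow>
       (1 + \<delta>) * N x \<le> N (\<lambda>t. x t + y t)"
    by (rule uniformly_monotone_scaled[OF assms(13) zero_less_one]) (rule that)
  \<comment> \<open>any \<open>b > 2 * C\<close> would do\<close>
  define b where "b = 2 * C + 1"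
  have decay: "\<phi> (u / b) \<le> ennreal (1 / (1 + \<delta>)) * \<phi> u" if "0 \<le> u" for u
  proof (cases "u = 0")
    case True
    then show ?thesis by (simp add: \<phi>0)
  next
    case False
    then have u: "0 < u" using that by simp
    then have "\<phi> 0 < \<phi> u" using assms(7) by (auto simp: strict_mono_on_def)
    then have fu: "0 < phi_real u" using ennreal_phi_real[of u] u \<phi>0 by (metis ennreal_less_zero_iff less_imp_le)
    obtain A B where AB: "A \<inter> B = {}" "indicat_real A \<in> E" "indicat_real B \<in> E"
      and NA: "N (indicat_real A) = 1 / phi_real u" and NB: "N (indicat_real B) = 1 / phi_real u"
      using disjoint_indicators_of_norm[OF assms(12,13,4,2,14,8), of "1 / phi_real u"] fu by auto
    have Un: "indicat_real (A \<union> B) = (\<lambda>t. indicat_real A t + indicat_real B t)"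
      using AB(1) by (rule indicator_Un_disjoint)
    have UE: "indicat_real (A \<union> B) \<in> E" unfolding Un using AB(2,3) by (rule add_mem)
    have big: "(1 + \<delta>) / phi_real u \<le> N (indicat_real (A \<union> B))"
      using um[OF indicator_positive_cone[OF AB(2)] indicator_positive_cone[OF AB(3)]]
      unfolding Un NA NB by simp
    have "luxemburg M E N \<phi> (\<lambda>t. u * indicat_real A t) \<le> 1"
      "luxemburg M E N \<phi> (\<lambda>t. u * indicat_real B t) \<le> 1"
      using AB(2,3) u fu by (auto intro!: luxemburg_indicator_le simp: NA NB)
    then have "C * (luxemburg M E N \<phi> (\<lambda>t. u * indicat_real A t) + luxemburg M E N \<phi> (\<lambda>t. u * indicat_real B t))
        \<le> C * (1 + 1)"
      using C by (intro mult_left_mono add_mono) auto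
    moreover have "luxemburg M E N \<phi> (\<lambda>t. u * indicat_real A t + u * indicat_real B t)
      \<le> C * (luxemburg M E N \<phi> (\<lambda>t. u * indicat_real A t) + luxemburg M E N \<phi> (\<lambda>t. u * indicat_real B t))"
      using AB(2,3) u by (intro quasi indicator_mem_orlicz_space)
    moreover have "(\<lambda>t. u * indicat_real A t + u * indicat_real B t) = (\<lambda>t. u * indicat_real (A \<union> B) t)"
      by (simp add: Un distrib_left)
    ultimately have "luxemburg M E N \<phi> (\<lambda>t. u * indicat_real (A \<union> B) t) < b"
      by (simp add: b_def)
    then have "phi_real (u / b) * N (indicat_real (A \<union> B)) \<le> 1"
      by (rule modular_le_1_if_luxemburg_less[OF UE u])
    moreover have "phi_real (u / b) * ((1 + \<delta>) / phi_real u) \<le> phi_real (u / b) * N (indicat_real (A \<union> B))"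
      using big phi_real_nonneg by (rule mult_left_mono)
    ultimately have "phi_real (u / b) * ((1 + \<delta>) / phi_real u) \<le> 1" by linarith
    then have "phi_real (u / b) \<le> 1 / (1 + \<delta>) * phi_real u"
      using fu \<delta> by (simp add: field_simps)
    then have "ennreal (phi_real (u / b)) \<le> ennreal (1 / (1 + \<delta>) * phi_real u)" by (rule ennreal_leI)
    also have "\<dots> = ennreal (1 / (1 + \<delta>)) * \<phi> u"
      using \<delta> fu u by (subst ennreal_mult) (auto simp: ennreal_phi_real)
    finally show ?thesis using u C by (simp add: ennreal_phi_real b_def)
  qed
  show ?thesis
    using \<delta> C by (intro alpha_index_pos[OF mono _ _ _ decay]) (auto simp: b_def)
qed

end
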